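(* Let $(X,\|\cdot\|)$ be a complex normed space and let $x,y\in X\setminus\{0\}$. Then $$\{(e^{i\varphi}x,\,y)\mid\varphi\in[0,2\pi]\}\cap\mathcal R_X^{\bullet}\neq\emptyset.$$
   Context: Let $(X,\|\cdot\|)$ be a complex normed vector space and let $i$ be the imaginary unit. The product $\langle\cdot\,|\,\cdot\rangle:X\times X\to\mathbb C$ is defined as follows: $\langle x|y\rangle:=0$ if $x=0$ or $y=0$, and otherwise $$\langle x|y\rangle:=\|x\|\,\|y\|\cdot\tfrac14\Big[\big\|\tfrac{x}{\|x\|}+\tfrac{y}{\|y\|}\big\|^2-\big\|\tfrac{x}{\|x\|}-\tfrac{y}{\|y\|}\big\|^2+i\Big(\big\|\tfrac{x}{\|x\|}+i\tfrac{y}{\|y\|}\big\|^2-\big\|\tfrac{x}{\|x\|}-i\tfrac{y}{\|y\|}\big\|^2\Big)\Big].$$ Let $\mathcal A:=\{a+ib\mid 0<a<\pi,\ b\in\mathbb R\}\cup\{0,\pi\}$ and $\mathcal B:=\mathbb C\setminus\{r\in\mathbb R\mid r<-1\text{ or }r>1\}$. The complex cosine restricts to a homeomorphism $\cos:\mathcal A\to\mathcal B$, and $\arccos:\mathcal B\to\mathcal A$ denotes its inverse. For $x,y\in X\setminus\{0\}$ the angle is the complex number $\angle(x,y):=\arccos\big(\langle x|y\rangle/(\|x\|\,\|y\|)\big)\in\mathcal A$ (the argument always lies in $\mathcal B$). $\mathcal R_X^{\bullet}$ denotes the set of pairs $(x,y)$ with $x,y\in X$, $x,y\ne0$ and $\angle(x,y)\in\mathbb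 R$. *)

theory Defs
  imports "HOL-Analysis.Analysis"
begin

text \<open>
  The library has no class of complex normed spaces. The class below extends
  \<open>real_normed_vector\<close>, so that \<open>norm\<close>, \<open>dist\<close> and the topology are the library's. This is no
  restriction: in a complex normed space the real scalar multiplication is the restriction of the
  complex one, and the metric and the topology are those of the norm.
\<close>

class complex_normed_vector = real_normed_vector +
  fixes scaleC :: "complex \<Rightarrow> 'a \<Rightarrow> 'a" (infixr "*\<^sub>C" 75)
  assumes scaleC_add_right: "a *\<^sub>C (x + y) = a *\<^sub>C x + a *\<^sub>C y"
    and scaleC_add_left: "(a + b) *\<^sub>C x = a *\<^sub>C x + b *\<^sub>C x"
    and scaleC_scaleC: "a *\<^sub>C (b *\<^sub>C x) = (a * b) *\<^sub>C x"
    and scaleC_one: "1 *\<^sub>C x = x"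
    and scaleR_scaleC: "r *\<^sub>R x = of_real r *\<^sub>C x"
    and norm_scaleC: "norm (a *\<^sub>C x) = cmod a * norm x"

instantiation complex :: complex_normed_vector
begin

definition scaleC_complex :: "complex \<Rightarrow> complex \<Rightarrow> complex"
  where "scaleC_complex a x = a * x"

instance
  by standard (simp_all add: scaleC_complex_def algebra_simps norm_mult scaleR_conv_of_real)

end

definition cprod :: "'a::complex_normed_vector \<Rightarrow> 'a \<Rightarrow> complex"
  where "cprod x y =
    (if x = 0 \<or> y = 0 then 0
     else let u = x /\<^sub>R norm x; v = y /\<^sub>R norm y in
       of_real (norm x * norm y) * (1 / 4) *
       (of_real ((norm (u + v))\<^sup>2 - (norm (u - v))\<^sup>2)
        + \<i> * of_real ((norm (u + \<i> *\<^sub>C v))\<^sup>2 - (norm (u - \<i> *\<^sub>C v))\<^sup>2)))"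

definition arccos_range :: "complex set"
  where "arccos_range = {z. 0 < Re z \<and> Re z < pi} \<union> {0, of_real pi}"

definition arccos_domain :: "complex set"
  where "arccos_domain = - {of_real r |r :: real. r < -1 \<or> r > 1}"

text \<open>Meaningful only on \<open>arccos_domain\<close>.\<close>

definition carccos :: "complex \<Rightarrow> complex"
  where "carccos = inv_into arccos_range cos"

definition cangle :: "'a::complex_normed_vector \<Rightarrow> 'a \<Rightarrow> complex"
  where "cangle x y = carccos (cprod x y / of_real (norm x * norm y))"

definition real_angle_pairs :: "('a::complex_normed_vector \<times> 'a) set"
  where "real_angle_pairs = {(x, y). x \<noteq> 0 \<and> y \<noteq> 0 \<and> cangle x y \<in> \<real>}"

lemma inj_on_cos_arccos_range: "inj_on cos arccos_range"
  by (rule inj_on_inverseI[where g = Arccos]) (auto simp: arccos_range_def intro!: Arccos_cos)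

lemma cos_arccos_range: "cos ` arccos_range = arccos_domain"
proof (intro equalityI subsetI)
  fix w assume "w \<in> cos ` arccos_range"
  then obtain z where z: "z \<in> arccos_range" "w = cos z" by blast
  show "w \<in> arccos_domain"
  proof (cases "0 < Re z \<and> Re z < pi")
    case True
    have "\<bar>Re w\<bar> \<le> 1" if "Im w = 0"
    proof -
      have "sin (Re z) > 0" using True by (simp add: sin_gt_zero)
      then have "Im z = 0" using that z(2) by (simp add: Im_cos)
      then show ?thesis using z(2) by (simp add: Re_cos)
    qed
    then show ?thesis by (auto simp: arccos_domain_def)
  next
    case False
    then have "w = 1 \<or> w = -1" using z by (auto simp: arccos_range_def simp flip: cos_of_real)
    then show ?thesis by (auto simp: arccos_domain_def complex_eq_iff)
  qed
next
  fix w assume w: "w \<in> arccos_domain"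
  show "w \<in> cos ` arccos_range"
  proof (cases "w = 1 \<or> w = -1")
    case True
    then show ?thesis
      by (auto simp: arccos_range_def image_iff simp flip: cos_of_real)
  next
    case False
    have "\<bar>Re w\<bar> < 1" if "Im w = 0"
    proof -
      have "w = of_real (Re w)" using that by (simp add: complex_eq_iff)
      then have "\<bar>Re w\<bar> \<le> 1" using w by (force simp: arccos_domain_def)
      moreover have "Re w \<noteq> 1" "Re w \<noteq> -1" using False that by (auto simp: complex_eq_iff)
      ultimately show ?thesis by linarith
    qed
    then have ne: "Im (w + \<i> * csqrt (1 - w\<^sup>2)) \<noteq> 0" using isCont_Arccos_lemma by blast
    define v where "v = w + \<i> * csqrt (1 - w\<^sup>2)"
    have v0: "v \<noteq> 0" and vi: "Im v \<noteq> 0" using ne by (auto simp: v_def Arccos_body_lemma)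
    have re: "Re (Arccos w) = Im (Ln v)" by (simp add: Re_Arccos v_def)
    have ne0: "Re (Arccos w) \<noteq> 0" "Re (Arccos w) \<noteq> pi"
      using vi v0 Im_Ln_eq_0[of v] Im_Ln_eq_pi[of v] unfolding re by auto
    show ?thesis
    proof (cases "Re (Arccos w) > 0")
      case True
      then have "Arccos w \<in> arccos_range"
        using ne0 Re_Arccos_bounds[of w] by (auto simp: arccos_range_def)
      then show ?thesis by (metis cos_Arccos image_eqI)
    next
      case False
      then have "- Arccos w \<in> arccos_range"
        using ne0 Re_Arccos_bounds[of w] by (auto simp: arccos_range_def)
      then show ?thesis by (metis cos_Arccos cos_minus image_eqI)
    qed
  qed
qed

lemma bij_betw_cos_arccos: "bij_betw cos arccos_range arccos_domain"
  by (simp add: bij_betw_def inj_on_cos_arccos_range cos_arccos_range)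

lemma carccos_eq_Arccos:
  assumes "w \<in> arccos_domain"
  shows "carccos w = Arccos w"
proof -
  have "carccos w \<in> arccos_range" "cos (carccos w) = w"
    using assms unfolding carccos_def
    by (simp_all add: cos_arccos_range inv_into_into f_inv_into_f)
  then show ?thesis
    by (intro Arccos_unique[symmetric]) (auto simp: arccos_range_def)
qed

lemma cprod_div_norms_in_arccos_domain:
  fixes x y :: "'a::complex_normed_vector"
  assumes "x \<noteq> 0" "y \<noteq> 0"
  shows "cprod x y / of_real (norm x * norm y) \<in> arccos_domain"
proof -
  define u v where "u = x /\<^sub>R norm x" and "v = y /\<^sub>R norm y"
  define q where "q = cprod x y / of_real (norm x * norm y)"
  have n: "norm u = 1" "norm v = 1" using assms by (simp_all add: u_def v_def)
  have "q = (1 / 4) * (of_real ((norm (u + v))\<^sup>2 - (norm (u - v))\<^sup>2)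
        + \<i> * of_real ((norm (u + \<i> *\<^sub>C v))\<^sup>2 - (norm (u - \<i> *\<^sub>C v))\<^sup>2))"
    using assms by (simp add: q_def cprod_def Let_def u_def v_def)
  moreover have "Re ((1 / 4) * (of_real a + \<i> * of_real b)) = a / 4" for a b :: real
    by simp
  ultimately have "Re q = ((norm (u + v))\<^sup>2 - (norm (u - v))\<^sup>2) / 4" by metis
  moreover have "(norm (u + v))\<^sup>2 \<le> 2\<^sup>2" "(norm (u - v))\<^sup>2 \<le> 2\<^sup>2"
    using norm_triangle_ineq[of u v] norm_triangle_ineq4[of u v] n
    by (intro power_mono; simp)+
  then have "(norm (u + v))\<^sup>2 \<le> 4" "(norm (u - v))\<^sup>2 \<le> 4" by simp_all
  moreover have "0 \<le> (norm (u + v))\<^sup>2" "0 \<le> (norm (u - v))\<^sup>2" by simp_all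
  moreover have "\<bar>r\<bar> \<le> 1" if "r = (a - b) / 4" "a \<le> 4" "b \<le> 4" "0 \<le> a" "0 \<le> b" for a b r :: real
    using that by (auto simp: abs_le_iff field_simps)
  ultimately have "\<bar>Re q\<bar> \<le> 1" by metis
  then show ?thesis unfolding q_def[symmetric] by (auto simp: arccos_domain_def)
qed

end

theory Submission
  imports Defs
begin

text \<open>
  The imaginary part of the argument of the arc cosine is a continuous function of the phase
  \<open>\<phi>\<close> that changes sign under \<open>\<phi> \<mapsto> \<phi> + \<pi>\<close>, so it vanishes somewhere on \<open>[0, \<pi>]\<close>. There the
  argument is real and, lying in the domain of the arc cosine, belongs to \<open>[-1, 1]\<close>.
\<close>

lemma scaleC_scaleR_commute:
  fixes x :: "'a::complex_normed_vector"
  shows "a *\<^sub>C (r *\<^sub>R x) = r *\<^sub>R (a *\<^sub>C x)"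
  by (simp add: scaleR_scaleC scaleC_scaleC mult.commute)

text \<open>Needed for continuity in the phase; linearity also yields the sign rule used at phase
  \<pi>.\<close>

lemma bounded_linear_scaleC_left:
  fixes x :: "'a::complex_normed_vector"
  shows "bounded_linear (\<lambda>a. a *\<^sub>C x)"
proof (rule bounded_linear_intro)
  show "(r *\<^sub>R a) *\<^sub>C x = r *\<^sub>R (a *\<^sub>C x)" for r a
    by (simp add: scaleR_conv_of_real[of r a] scaleR_scaleC[of r "a *\<^sub>C x"] scaleC_scaleC)
  show "norm (a *\<^sub>C x) \<le> norm a * norm x" for a
    by (simp add: norm_scaleC)
qed (rule scaleC_add_left)

lemma scaleC_minus_left:
  fixes x :: "'a::complex_normed_vector"
  shows "(- a) *\<^sub>C x = - (a *\<^sub>C x)"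
  by (rule linear_neg[OF bounded_linear.linear[OF bounded_linear_scaleC_left]])

text \<open>The factor \<open>norm x * norm y\<close> cancels, and both differences of squared norms
  are real, so only the one multiplied by \<open>\<i>\<close> survives.\<close>

lemma Im_cprod_div_norms:
  fixes x y :: "'a::complex_normed_vector"
  assumes "x \<noteq> 0" "y \<noteq> 0"
  defines "u \<equiv> x /\<^sub>R norm x" and "v \<equiv> y /\<^sub>R norm y"
  shows "Im (cprod x y / of_real (norm x * norm y)) =
    ((norm (u + \<i> *\<^sub>C v))\<^sup>2 - (norm (u - \<i> *\<^sub>C v))\<^sup>2) / 4"
proof -
  define a where "a = (norm (u + v))\<^sup>2 - (norm (u - v))\<^sup>2"
  define b where "b = (norm (u + \<i> *\<^sub>C v))\<^sup>2 - (norm (u - \<i> *\<^sub>C v))\<^sup>2"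
  have "cprod x y = of_real (norm x * norm y) * ((1 / 4) * (of_real a + \<i> * of_real b))"
    using assms by (simp add: cprod_def Let_def a_def b_def mult.assoc)
  then have "cprod x y / of_real (norm x * norm y) = (1 / 4) * (of_real a + \<i> * of_real b)"
    using assms by simp
  then have "Im (cprod x y / of_real (norm x * norm y)) = b / 4"
    by (simp only:) simp
  then show ?thesis unfolding b_def .
qed

text \<open>A real point of \<open>arccos_domain\<close> lies in [-1, 1], where the complex arc
  cosine agrees with the real one.\<close>

lemma carccos_in_Reals:
  assumes "w \<in> arccos_domain" "Im w = 0"
  shows "carccos w \<in> \<real>"
proof -
  have w: "w = of_real (Re w)" using assms by (simp add: complex_eq_iff)
  then have "\<bar>Re w\<bar> \<le> 1" using assms(1) by (force simp: arccos_domain_def)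
  then have "Arccos w = of_real (arccos (Re w))"
    using w of_real_arccos[of "Re w"] by (metis abs_le_iff minus_le_iff)
  then show ?thesis by (simp add: carccos_eq_Arccos assms)
qed

theorem proposition3p24:
  fixes x y :: "'a::complex_normed_vector"
  assumes "x \<noteq> 0" and "y \<noteq> 0"
  shows "{(exp (\<i> * of_real \<phi>) *\<^sub>C x, y) |\<phi> :: real. \<phi> \<in> {0..2 * pi}} \<inter> real_angle_pairs \<noteq> {}"
proof -
  \<comment> \<open>The factor \<open>\<i>\<close> is absorbed into \<open>v\<close>, so that
    \<open>f \<phi>\<close> below is four times the imaginary part of the argument for the pair with
    \<open>x\<close> rotated by \<phi>.\<close>
  define u v where "u = x /\<^sub>R norm x" and "v = \<i> *\<^sub>C (y /\<^sub>R norm y)"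
  define f :: "real \<Rightarrow> real" where "f \<phi> =
    (norm (exp (\<i> * of_real \<phi>) *\<^sub>C u + v))\<^sup>2 - (norm (exp (\<i> * of_real \<phi>) *\<^sub>C u - v))\<^sup>2" for \<phi>
  have cont: "continuous_on {0..pi} f"
    unfolding f_def
    by (intro continuous_intros bounded_linear.continuous_on[OF bounded_linear_scaleC_left])
  \<comment> \<open>Since exp(i \<pi>) = -1, passing from 0 to \<pi> replaces \<open>u\<close> by
    \<open>- u\<close>, which swaps the two norms.\<close>
  have "f pi = - f 0"
    using norm_minus_commute[of v u] norm_minus_cancel[of "u + v"]
    by (simp add: f_def scaleC_minus_left scaleC_one norm_minus_commute add.commute)
  then have "f 0 \<le> 0 \<and> 0 \<le> f pi \<or> f pi \<le> 0 \<and> 0 \<le> f 0" by linarith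
  \<comment> \<open>The sign of \<open>f 0\<close> is unknown, hence both the increasing and the
    decreasing form of the intermediate value theorem.\<close>
  then obtain \<phi> where \<phi>: "0 \<le> \<phi>" "\<phi> \<le> pi" "f \<phi> = 0"
    using IVT'[of f 0 0 pi] IVT2'[of f pi 0 0] cont pi_ge_zero by blast
  define x' where "x' = exp (\<i> * of_real \<phi>) *\<^sub>C x"
  \<comment> \<open>The phase has modulus 1, so normalising \<open>x'\<close> gives exactly the
    rotated \<open>u\<close> that occurs in \<open>f\<close>.\<close>
  have norm_x': "norm x' = norm x" by (simp add: x'_def norm_scaleC)
  then have "x' \<noteq> 0" using assms(1) by auto
  have "x' /\<^sub>R norm x' = exp (\<i> * of_real \<phi>) *\<^sub>C u"
    unfolding norm_x' by (simp add: x'_def u_def scaleC_scaleR_commute)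
  then have "Im (cprod x' y / of_real (norm x' * norm y)) = 0"
    using \<phi>(3) Im_cprod_div_norms[OF \<open>x' \<noteq> 0\<close> assms(2)] by (simp add: f_def v_def)
  then have "cangle x' y \<in> \<real>"
    unfolding cangle_def
    by (intro carccos_in_Reals cprod_div_norms_in_arccos_domain \<open>x' \<noteq> 0\<close> assms(2))
  then have "(x', y) \<in> real_angle_pairs"
    using \<open>x' \<noteq> 0\<close> assms(2) by (simp add: real_angle_pairs_def)
  moreover have "\<phi> \<in> {0..2 * pi}" using \<phi> by simp
  ultimately show ?thesis unfolding x'_def by blast
qed

end
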